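(* Let $n\geq 1$ and $k\geq 1$ be integers, and let $\mathcal{F}=\{F_1,\ldots,F_m\}$ be a $k$-uniform family of $m$ (pairwise distinct) subsets of $[n]$. If $|\mathcal{F}|=m\geq n+1$, then $\mathcal{F}$ is a balanced family; that is, there exist two non-empty disjoint subsets $I_1$ and $I_2$ of $\{1,\ldots,m\}$ such that $$\bigcup_{i\in I_1} F_i=\bigcup_{i\in I_2} F_i \quad\text{and}\quad \bigcap_{i\in I_1} F_i=\bigcap_{i\in I_2} F_i.$$
   Context: Here $[n]=\{1,2,\ldots,n\}$. A family $\mathcal{F}$ of subsets of $[n]$ is $k$-uniform if $|F|=k$ for every $F\in\mathcal{F}$. A family $\mathcal{F}=\{F_i : i\in I\}$ of subsets of $[n]$ (with distinct members indexed by $I$) is called balanced if there exist two non-empty disjoint subsets $I_1,I_2\subseteq I$ with $\bigcup_{i\in I_1}F_i=\bigcup_{i\in I_2}F_i$ and $\bigcap_{i\in I_1}F_i=\bigcap_{i\in I_2}F_i$. *)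

theory Defs
  imports Main
begin

(* Families are indexed: the members are F i for i in I.  Distinctness of the members
   (injectivity of F on I) is not part of these predicates and is to be assumed separately. *)

definition uniform_family :: "nat \<Rightarrow> 'i set \<Rightarrow> ('i \<Rightarrow> 'a set) \<Rightarrow> bool" where
  "uniform_family k I F \<longleftrightarrow> (\<forall>i\<in>I. finite (F i) \<and> card (F i) = k)"

definition balanced_family :: "'i set \<Rightarrow> ('i \<Rightarrow> 'a set) \<Rightarrow> bool" where
  "balanced_family I F \<longleftrightarrow>
     (\<exists>I1 I2. I1 \<subseteq> I \<and> I2 \<subseteq> I \<and> I1 \<noteq> {} \<and> I2 \<noteq> {} \<and> I1 \<inter> I2 = {} \<and>
        (\<Union>i\<in>I1. F i) = (\<Union>i\<in>I2. F i) \<and> (\<Inter>i\<in>I1. F i) = (\<Inter>i\<in>I2. F i))"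

end

theory Submission
  imports Defs Complex_Main
begin

text \<open>
  More than \<open>n\<close> indicator vectors of subsets of \<open>[n]\<close> are linearly dependent. Summing a dependency
  over all coordinates gives \<open>k\<close> times the sum of its coefficients, so this sum vanishes and the
  same coefficients are also a dependency of the indicator vectors of the complements.
  Take for \<open>I\<^sub>1\<close> and \<open>I\<^sub>2\<close> the indices with positive and with negative coefficient: the first
  dependency equates the unions of the sets, the second one the unions of their complements.
\<close>

text \<open>Gaussian elimination, one equation \<open>j\<close> at a time: a pivot unknown
  \<open>p\<close> with \<open>A p j \<noteq> 0\<close> is eliminated, leaving one equation and one
  unknown fewer. Elimination changes the coefficients, so the induction generalises over
  \<open>A\<close> and \<open>I\<close>.\<close>

lemma homogeneous_system_nontrivial_solution:
  fixes A :: "'i \<Rightarrow> 'j \<Rightarrow> 'b::field"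
  assumes "finite J" "finite I" "card J < card I"
  shows "\<exists>c. (\<exists>i\<in>I. c i \<noteq> 0) \<and> (\<forall>j\<in>J. (\<Sum>i\<in>I. c i * A i j) = 0)"
  using assms
proof (induction J arbitrary: I A rule: finite_induct)
  case empty
  then have "I \<noteq> {}" by auto
  then show ?case by (auto intro!: exI[of _ "\<lambda>_. 1"])
next
  case (insert j J)
  show ?case
  proof (cases "\<forall>i\<in>I. A i j = 0")
    case True
    have "card J < card I" using insert by simp
    from insert.IH[OF insert.prems(1) this, of A] True show ?thesis by auto
  next
    case False
    then obtain p where p: "p \<in> I" "A p j \<noteq> 0" by blast
    define I' where "I' = I - {p}"
    have I': "finite I'" "p \<notin> I'" "I = insert p I'"
      using insert.prems p by (auto simp: I'_def)
    have "card J < card I'"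
      using insert I' by simp
    from insert.IH[OF I'(1) this, of "\<lambda>i l. A i l - A i j / A p j * A p l"]
    obtain c where c: "\<exists>i\<in>I'. c i \<noteq> 0"
      "\<forall>l\<in>J. (\<Sum>i\<in>I'. c i * (A i l - A i j / A p j * A p l)) = 0" by blast
    define s where "s = (\<Sum>i\<in>I'. c i * A i j / A p j)"
    \<comment> \<open>Back substitution: with this value at the pivot, each original equation at
      \<open>d\<close> equals the reduced one at \<open>c\<close>. For \<open>l = j\<close> all
      reduced coefficients are zero.\<close>
    define d where "d = c(p := - s)"
    have sum_d: "(\<Sum>i\<in>I. d i * A i l) = (\<Sum>i\<in>I'. c i * (A i l - A i j / A p j * A p l))" for l
    proof -
      have "(\<Sum>i\<in>I. d i * A i l) = - s * A p l + (\<Sum>i\<in>I'. d i * A i l)"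
        using I' by (simp add: d_def)
      also have "(\<Sum>i\<in>I'. d i * A i l) = (\<Sum>i\<in>I'. c i * A i l)"
        using I'(2) by (intro sum.cong) (auto simp: d_def)
      also have "- s * A p l + (\<Sum>i\<in>I'. c i * A i l) =
          (\<Sum>i\<in>I'. c i * (A i l - A i j / A p j * A p l))"
        by (simp add: s_def sum_distrib_right right_diff_distrib sum_subtractf mult.assoc)
      finally show ?thesis .
    qed
    have "\<exists>i\<in>I. d i \<noteq> 0"
      using c(1) I' by (auto simp: d_def)
    moreover have "\<forall>l\<in>insert j J. (\<Sum>i\<in>I. d i * A i l) = 0"
      using c(2) p(2) by (simp add: sum_d)
    ultimately show ?thesis by blast
  qed
qed

text \<open>A vanishing sum with a negative term also has a positive one; the converse is the same
  fact for \<open>- c\<close>.\<close>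

lemma sum_eq_0_neg_iff_pos:
  fixes c :: "'i \<Rightarrow> 'b::linordered_idom"
  assumes "finite I" "(\<Sum>i\<in>I. c i * of_bool (P i)) = 0"
  shows "(\<exists>i\<in>I. c i < 0 \<and> P i) \<longleftrightarrow> (\<exists>i\<in>I. c i > 0 \<and> P i)"
proof -
  have "\<exists>i\<in>I. d i > 0 \<and> P i"
    if sum_d: "(\<Sum>i\<in>I. d i * of_bool (P i)) = 0" and ex: "\<exists>i\<in>I. d i < 0 \<and> P i"
    for d :: "'i \<Rightarrow> 'b"
  proof (rule ccontr)
    assume "\<not> ?thesis"
    then have "\<forall>i\<in>I. d i * of_bool (P i) \<le> 0" by (auto simp: not_less)
    moreover from ex have "\<exists>i\<in>I. d i * of_bool (P i) < 0" by auto
    ultimately have "(\<Sum>i\<in>I. d i * of_bool (P i)) < (\<Sum>i\<in>I. 0)"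
      using assms(1) by (intro sum_strict_mono_ex1) auto
    with sum_d show False by simp
  qed
  from this[of c] this[of "\<lambda>i. - c i"] assms(2) show ?thesis
    by (auto simp: sum_negf)
qed

lemma balanced_family_if_dependent:
  fixes c :: "'i \<Rightarrow> 'b::linordered_idom"
  assumes I: "finite I" and c: "\<exists>i\<in>I. c i \<noteq> 0" and sum_c: "sum c I = 0"
    and dep: "\<And>x. (\<Sum>i\<in>I. c i * of_bool (x \<in> F i)) = 0"
  shows "balanced_family I F"
proof -
  have "(\<Sum>i\<in>I. c i * of_bool (x \<notin> F i)) = 0" for x
    using sum_c dep[of x] by (simp add: of_bool_not_iff right_diff_distrib sum_subtractf)
  then have notin: "(\<exists>i\<in>I. c i < 0 \<and> x \<notin> F i) \<longleftrightarrow> (\<exists>i\<in>I. c i > 0 \<and> x \<notin> F i)" for x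
    by (rule sum_eq_0_neg_iff_pos[OF I])
  have mem: "(\<exists>i\<in>I. c i < 0 \<and> x \<in> F i) \<longleftrightarrow> (\<exists>i\<in>I. c i > 0 \<and> x \<in> F i)" for x
    by (rule sum_eq_0_neg_iff_pos[OF I dep])
  \<comment> \<open>Both signs must occur, so that neither index set is empty.\<close>
  have "(\<exists>i\<in>I. c i < 0) \<longleftrightarrow> (\<exists>i\<in>I. c i > 0)"
    using sum_eq_0_neg_iff_pos[OF I, of c "\<lambda>_. True"] sum_c by simp
  then have ne: "\<exists>i\<in>I. c i < 0" "\<exists>i\<in>I. c i > 0"
    using c by (auto simp: neq_iff)
  show ?thesis
    unfolding balanced_family_def
  proof (intro exI conjI)
    show "(\<Union>i\<in>{i\<in>I. c i > 0}. F i) = (\<Union>i\<in>{i\<in>I. c i < 0}. F i)"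
      using mem by blast
    \<comment> \<open>A point lies outside an intersection iff some member misses it.\<close>
    show "(\<Inter>i\<in>{i\<in>I. c i > 0}. F i) = (\<Inter>i\<in>{i\<in>I. c i < 0}. F i)"
      using notin by blast
  qed (use ne in auto)
qed

lemma uniform_family_balanced:
  fixes F :: "'i \<Rightarrow> 'a set"
  assumes V: "finite V" and I: "finite I" and sub: "\<And>i. i \<in> I \<Longrightarrow> F i \<subseteq> V"
    and unif: "uniform_family k I F" and k: "k \<noteq> 0" and card: "card V < card I"
  shows "balanced_family I F"
proof -
  \<comment> \<open>The rationals allow both division in the elimination and splitting by
    sign.\<close>
  obtain c :: "'i \<Rightarrow> rat" where c: "\<exists>i\<in>I. c i \<noteq> 0"
    and depV: "\<forall>x\<in>V. (\<Sum>i\<in>I. c i * of_bool (x \<in> F i)) = 0"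
    using homogeneous_system_nontrivial_solution[OF V I card, of "\<lambda>i x. of_bool (x \<in> F i)"]
    by blast
  have dep: "(\<Sum>i\<in>I. c i * of_bool (x \<in> F i)) = 0" for x
  proof (cases "x \<in> V")
    case False
    then have "x \<notin> F i" if "i \<in> I" for i using sub that by blast
    then show ?thesis by simp
  qed (use depV in blast)
  have size: "(\<Sum>x\<in>V. of_bool (x \<in> F i)) = (of_nat k :: rat)" if "i \<in> I" for i
  proof -
    have "V \<inter> F i = F i" using sub[OF that] by blast
    then show ?thesis
      using V unif that by (simp add: sum_of_bool_eq uniform_family_def Int_def)
  qed
  \<comment> \<open>Double counting: each \<open>F i\<close> has \<open>k\<close> points in
    \<open>V\<close>, and swapping the sums gives a zero inner sum at every point.\<close>
  have "of_nat k * sum c I = (\<Sum>i\<in>I. c i * (\<Sum>x\<in>V. of_bool (x \<in> F i)))"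
    by (simp add: size sum_distrib_left mult.commute)
  also have "\<dots> = (\<Sum>x\<in>V. \<Sum>i\<in>I. c i * of_bool (x \<in> F i))"
    by (simp only: sum_distrib_left sum.swap[of _ V I])
  also have "\<dots> = 0" by (simp only: dep sum.neutral_const)
  finally have "sum c I = 0" using k by simp
  from balanced_family_if_dependent[OF I c this dep] show ?thesis .
qed

theorem theorem1p3:
  fixes n k m :: nat and F :: "nat \<Rightarrow> nat set"
  assumes "n \<ge> 1" and "k \<ge> 1"
    and "\<And>i. i \<in> {1..m} \<Longrightarrow> F i \<subseteq> {1..n}"
    and "inj_on F {1..m}"
    and "uniform_family k {1..m} F"
    and "m \<ge> n + 1"
  shows "balanced_family {1..m} F"
  using uniform_family_balanced[of "{1..n}" "{1..m}" F k] assms by simp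

end
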